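(* Let $\mathcal{G}$ be an ultragraph and $R$ a unital commutative ring. There exists a representation $\pi:L_R(\mathcal{G})\rightarrow \mathrm{End}_R(\mathbb{P})$ such that $\pi(p_A)=P_A$ for all $A\in \mathcal{G}^0$, and $\pi(s_e)=S_e$ and $\pi(s_e^* )=S_e^*$ for each edge $e\in\mathcal{G}^1$.
   Context: An ultragraph is a quadruple $\mathcal{G}=(G^0,\mathcal{G}^1,r,s)$ where $G^0,\mathcal{G}^1$ are countable sets, $s:\mathcal{G}^1\to G^0$ and $r:\mathcal{G}^1\to P(G^0)\setminus\{\emptyset\}$ are maps ($P(G^0)$ is the power set). $\mathcal{G}^0$ is the smallest subset of $P(G^0)$ containing $\{v\}$ for all $v\in G^0$ and $r(e)$ for all $e\in\mathcal{G}^1$, and closed under finite unions and non-empty finite intersections. A vertex $v$ is a sink if $s^{-1}(v)=\emptyset$; $G^0_s$ is the set of sinks. $L_R(\mathcal{G})$ is the universal (not necessarily unital) $R$-algebra with generators $\{s_e,s_e^*:e\in\mathcal{G}^1\}\cup\{p_A:A\in\mathcal{G}^0\}$ and relations: (1) $p_\emptyset=0$, $p_Ap_B=p_{A\cap B}$, $p_{A\cup B}=p_A+p_B-p_{A\cap B}$ for all $A,B\in\mathcal{G}^0$; (2) $p_{s(e)}s_e=s_ep_{r(e)}=s_e$ and $p_{r(e)}s_e^*=s_e^*p_{s(e)}=s_e^*$ for each $e$; (3) $s_e^*s_f=\delta_{e,f}p_{r(e)}$ for all $e,f$; (4) $p_v=\sum_{s(e)=v}s_es_e^*$ whenever $0<|s^{-1}(v)|<\infty$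 (where $p_v=p_{\{v\}}$). A representation of $L_R(\mathcal{G})$ on an $R$-module $M$ is an $R$-algebra homomorphism $L_R(\mathcal{G})\to \mathrm{End}_R(M)$. A finite path of length $n\ge1$ is a sequence of edges $\alpha=e_1\dots e_n$ with $s(e_{i+1})\in r(e_i)$ for $1\le i\le n-1$; $s(\alpha)=s(e_1)$, $r(\alpha)=r(e_n)$. An infinite path is a sequence $e_1e_2e_3\dots$ of edges with $s(e_{i+1})\in r(e_i)$ for all $i\ge1$, with source $s(e_1)$. $\mathfrak{p}^\infty$ is the set of infinite paths, and $\mathfrak{p}^*=\{(\alpha,v):\alpha \text{ a finite path of length}\ge1,\ v\in r(\alpha)\cap G^0_s\}\cup\{(v,v):v\in G^0_s\}$, with $s(\alpha,v)=s(\alpha)$ and $s(v,v)=v$. $\mathbb{P}$ is the free $R$-module with basis $\{b_\alpha:\alpha\in\mathfrak{p}^*\cup\mathfrak{p}^\infty\}$. For a statement $q$, $[q]=1$ if $q$ is true and $0$ otherwise. Define $R$-linear maps $\mathbb{P}\to\mathbb{P}$: for $A\in\mathcal{G}^0$, $P_A(b_\alpha)=[s(\alpha)\in A]b_\alpha$; for $e\in\mathcal{G}^1$, $S_e(b_\alpha)=[s(\alpha)\in r(e)]b_{e\alpha}$ and $S_e^*(b_\alpha)=[\alpha_1=e]b_{\alpha_2\alpha_3\dots}$. Here, for $\alpha=(a,v)\in\mathfrak{p}^*$ with $a$ a finite path of positive length, $e\alpha=(ea,v)$, $\alpha_1=a_1$, and $b_{\alpha_2\alpha_3\dots}$ means $b_{(a_2\dots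 a_{|a|},v)}$ if $|a|\ge2$ and $b_{(v,v)}$ if $|a|=1$; for $\alpha=(v,v)$ with $v\in r(e)$, $e\alpha=(e,v)$; and $S_e^*(b_{(v,v)})=0$. *)

theory Defs
  imports "HOL-Algebra.Module" "HOL-Library.Countable_Set"
begin

section \<open>Ultragraphs\<close>

record ('v, 'e) ultragraph =
  verts :: "'v set"
  edges :: "'e set"
  src :: "'e \<Rightarrow> 'v"
  rng :: "'e \<Rightarrow> 'v set"

locale ultragraph =
  fixes G :: "('v, 'e) ultragraph"
  assumes countable_verts: "countable (verts G)"
    and countable_edges: "countable (edges G)"
    and src_in_verts: "e \<in> edges G \<Longrightarrow> src G e \<in> verts G"
    and rng_subset_verts: "e \<in> edges G \<Longrightarrow> rng G e \<subseteq> verts G"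
    and rng_nonempty: "e \<in> edges G \<Longrightarrow> rng G e \<noteq> {}"

text \<open>
  The family of sets that the projections are indexed by. Only intersections are restricted to
  nonempty families; the empty union is allowed, so the empty set is always a member, as the
  relation on the projection of the empty set requires.
\<close>

inductive_set gen_verts :: "('v, 'e) ultragraph \<Rightarrow> 'v set set"
  for G :: "('v, 'e) ultragraph" where
  singleton: "v \<in> verts G \<Longrightarrow> {v} \<in> gen_verts G"
| range: "e \<in> edges G \<Longrightarrow> rng G e \<in> gen_verts G"
| union: "finite F \<Longrightarrow> \<forall>A\<in>F. A \<in> gen_verts G \<Longrightarrow> \<Union>F \<in> gen_verts G"
| inter: "finite F \<Longrightarrow> F \<noteq> {} \<Longrightarrow> \<forall>A\<in>F. A \<in> gen_verts G \<Longrightarrow> \<Inter>F \<in> gen_verts G"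

definition out_edges :: "('v, 'e) ultragraph \<Rightarrow> 'v \<Rightarrow> 'e set" where
  "out_edges G v = {e \<in> edges G. src G e = v}"

definition sinks :: "('v, 'e) ultragraph \<Rightarrow> 'v set" where
  "sinks G = {v \<in> verts G. out_edges G v = {}}"

lemma gen_verts_empty: "{} \<in> gen_verts G"
  using gen_verts.union[of "{}" G] by simp

lemma gen_verts_Un: "A \<in> gen_verts G \<Longrightarrow> B \<in> gen_verts G \<Longrightarrow> A \<union> B \<in> gen_verts G"
  using gen_verts.union[of "{A, B}" G] by simp

lemma gen_verts_Int: "A \<in> gen_verts G \<Longrightarrow> B \<in> gen_verts G \<Longrightarrow> A \<inter> B \<in> gen_verts G"
  using gen_verts.inter[of "{A, B}" G] by simp


section \<open>Algebras that need not be unital or commutative\<close>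

text \<open>
  Algebras are carried by the record type of modules; its field \<open>one\<close> plays no role here. The locale
  \<open>algebra\<close> of HOL-Algebra only covers commutative unital algebras.
\<close>

locale assoc_algebra = module +
  assumes mult_closed: "\<lbrakk>x \<in> carrier M; y \<in> carrier M\<rbrakk> \<Longrightarrow> x \<otimes>\<^bsub>M\<^esub> y \<in> carrier M"
    and mult_assoc:
      "\<lbrakk>x \<in> carrier M; y \<in> carrier M; z \<in> carrier M\<rbrakk> \<Longrightarrow>
       (x \<otimes>\<^bsub>M\<^esub> y) \<otimes>\<^bsub>M\<^esub> z = x \<otimes>\<^bsub>M\<^esub> (y \<otimes>\<^bsub>M\<^esub> z)"
    and mult_l_distr:
      "\<lbrakk>x \<in> carrier M; y \<in> carrier M; z \<in> carrier M\<rbrakk> \<Longrightarrow>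
       (x \<oplus>\<^bsub>M\<^esub> y) \<otimes>\<^bsub>M\<^esub> z = (x \<otimes>\<^bsub>M\<^esub> z) \<oplus>\<^bsub>M\<^esub> (y \<otimes>\<^bsub>M\<^esub> z)"
    and mult_r_distr:
      "\<lbrakk>x \<in> carrier M; y \<in> carrier M; z \<in> carrier M\<rbrakk> \<Longrightarrow>
       x \<otimes>\<^bsub>M\<^esub> (y \<oplus>\<^bsub>M\<^esub> z) = (x \<otimes>\<^bsub>M\<^esub> y) \<oplus>\<^bsub>M\<^esub> (x \<otimes>\<^bsub>M\<^esub> z)"
    and smult_mult_l:
      "\<lbrakk>a \<in> carrier R; x \<in> carrier M; y \<in> carrier M\<rbrakk> \<Longrightarrow>
       (a \<odot>\<^bsub>M\<^esub> x) \<otimes>\<^bsub>M\<^esub> y = a \<odot>\<^bsub>M\<^esub> (x \<otimes>\<^bsub>M\<^esub> y)"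
    and smult_mult_r:
      "\<lbrakk>a \<in> carrier R; x \<in> carrier M; y \<in> carrier M\<rbrakk> \<Longrightarrow>
       x \<otimes>\<^bsub>M\<^esub> (a \<odot>\<^bsub>M\<^esub> y) = a \<odot>\<^bsub>M\<^esub> (x \<otimes>\<^bsub>M\<^esub> y)"

definition alg_hom ::
  "('r, 'm) ring_scheme \<Rightarrow> ('r, 'a, 'n) module_scheme \<Rightarrow> ('r, 'b, 'k) module_scheme \<Rightarrow> ('a \<Rightarrow> 'b) set"
  where
  "alg_hom R A B =
     {h \<in> carrier A \<rightarrow> carrier B.
        (\<forall>x\<in>carrier A. \<forall>y\<in>carrier A. h (x \<oplus>\<^bsub>A\<^esub> y) = h x \<oplus>\<^bsub>B\<^esub> h y) \<and>
        (\<forall>c\<in>carrier R. \<forall>x\<in>carrier A. h (c \<odot>\<^bsub>A\<^esub> x) = c \<odot>\<^bsub>B\<^esub> h x) \<and>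
        (\<forall>x\<in>carrier A. \<forall>y\<in>carrier A. h (x \<otimes>\<^bsub>A\<^esub> y) = h x \<otimes>\<^bsub>B\<^esub> h y)}"

definition End_alg ::
  "('r, 'm) ring_scheme \<Rightarrow> ('r, 'a, 'n) module_scheme \<Rightarrow> ('r, 'a \<Rightarrow> 'a) module" where
  "End_alg R M = \<lparr>
     carrier = {f \<in> carrier M \<rightarrow>\<^sub>E carrier M.
        (\<forall>x\<in>carrier M. \<forall>y\<in>carrier M. f (x \<oplus>\<^bsub>M\<^esub> y) = f x \<oplus>\<^bsub>M\<^esub> f y) \<and>
        (\<forall>c\<in>carrier R. \<forall>x\<in>carrier M. f (c \<odot>\<^bsub>M\<^esub> x) = c \<odot>\<^bsub>M\<^esub> f x)},
     mult = (\<lambda>f g. compose (carrier M) f g),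
     one = (\<lambda>x\<in>carrier M. x),
     zero = (\<lambda>x\<in>carrier M. \<zero>\<^bsub>M\<^esub>),
     add = (\<lambda>f g. \<lambda>x\<in>carrier M. f x \<oplus>\<^bsub>M\<^esub> g x),
     smult = (\<lambda>c f. \<lambda>x\<in>carrier M. c \<odot>\<^bsub>M\<^esub> f x)\<rparr>"

lemma assoc_algebra_End:
  assumes "module R M"
  shows "assoc_algebra R (End_alg R M)"
proof -
  interpret module R M by fact
  have swap: "a \<odot>\<^bsub>M\<^esub> (b \<odot>\<^bsub>M\<^esub> x) = b \<odot>\<^bsub>M\<^esub> (a \<odot>\<^bsub>M\<^esub> x)"
    if "a \<in> carrier R" "b \<in> carrier R" "x \<in> carrier M" for a b x
    using that R.m_comm[of a b] by (simp flip: smult_assoc1)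
  have ab: "abelian_group (End_alg R M)"
  proof (rule abelian_groupI, goal_cases)
    case (6 f)
    then show ?case
      by (intro bexI[of _ "\<lambda>x\<in>carrier M. \<ominus>\<^bsub>M\<^esub> f x"])
         (auto simp: End_alg_def PiE_iff M.l_neg M.minus_add smult_r_minus intro!: restrict_ext)
  next
    case (3 f g h)
    then show ?case by (auto simp: End_alg_def PiE_iff M.a_assoc intro!: restrict_ext)
  next
    case (4 f g)
    then show ?case by (auto simp: End_alg_def PiE_iff M.a_comm intro!: restrict_ext)
  next
    case (5 f)
    then show ?case by (auto simp: End_alg_def PiE_iff extensional_def)
  qed (auto simp: End_alg_def PiE_iff M.a_ac smult_r_distr)
  have "module R (End_alg R M)"
  proof (rule moduleI[OF R.is_cring ab], goal_cases)
    case (1 a f)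
    then show ?case by (auto simp: End_alg_def PiE_iff smult_r_distr swap)
  next
    case (2 a b f)
    then show ?case by (auto simp: End_alg_def PiE_iff smult_l_distr intro!: restrict_ext)
  next
    case (3 a f g)
    then show ?case by (auto simp: End_alg_def PiE_iff smult_r_distr intro!: restrict_ext)
  next
    case (4 a b f)
    then show ?case by (auto simp: End_alg_def PiE_iff smult_assoc1 intro!: restrict_ext)
  next
    case (5 f)
    then show ?case by (auto simp: End_alg_def PiE_iff extensional_def)
  qed
  then show ?thesis
  proof (rule assoc_algebra.intro, unfold_locales, goal_cases)
    case (2 f g h)
    then show ?case by (auto simp: End_alg_def PiE_iff compose_def intro!: restrict_ext)
  qed (auto simp: End_alg_def PiE_iff compose_def intro!: restrict_ext)
qed

definition representations ::
  "('r, 'm) ring_scheme \<Rightarrow> ('r, 'a, 'n) module_scheme \<Rightarrow> ('r, 'b, 'k) module_scheme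
    \<Rightarrow> ('a \<Rightarrow> 'b \<Rightarrow> 'b) set" where
  "representations R A M = alg_hom R A (End_alg R M)"


section \<open>Algebras presented by generators and relations\<close>

text \<open>
  The universal algebra on generators \<open>X\<close> subject to relations \<open>E\<close> (pairs of terms to be identified):
  formal terms modulo the smallest congruence that contains \<open>E\<close> and the axioms of a (not necessarily
  unital) algebra. No formal unit is adjoined.
\<close>

datatype ('r, 'g) alg_term =
    TGen 'g
  | TZero
  | TPlus "('r, 'g) alg_term" "('r, 'g) alg_term"
  | TTimes "('r, 'g) alg_term" "('r, 'g) alg_term"
  | TScale 'r "('r, 'g) alg_term"

inductive_set alg_terms :: "('r, 'm) ring_scheme \<Rightarrow> 'g set \<Rightarrow> ('r, 'g) alg_term set"
  for R :: "('r, 'm) ring_scheme" and X :: "'g set" where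
  gen: "g \<in> X \<Longrightarrow> TGen g \<in> alg_terms R X"
| zero: "TZero \<in> alg_terms R X"
| plus: "t \<in> alg_terms R X \<Longrightarrow> u \<in> alg_terms R X \<Longrightarrow> TPlus t u \<in> alg_terms R X"
| times: "t \<in> alg_terms R X \<Longrightarrow> u \<in> alg_terms R X \<Longrightarrow> TTimes t u \<in> alg_terms R X"
| scale: "c \<in> carrier R \<Longrightarrow> t \<in> alg_terms R X \<Longrightarrow> TScale c t \<in> alg_terms R X"

inductive_set alg_cong ::
  "('r, 'm) ring_scheme \<Rightarrow> 'g set \<Rightarrow> (('r, 'g) alg_term \<times> ('r, 'g) alg_term) set
    \<Rightarrow> (('r, 'g) alg_term \<times> ('r, 'g) alg_term) set"
  for R :: "('r, 'm) ring_scheme" and X :: "'g set"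
    and E :: "(('r, 'g) alg_term \<times> ('r, 'g) alg_term) set" where
  relation: "(t, u) \<in> E \<Longrightarrow> t \<in> alg_terms R X \<Longrightarrow> u \<in> alg_terms R X \<Longrightarrow> (t, u) \<in> alg_cong R X E"
| refl: "t \<in> alg_terms R X \<Longrightarrow> (t, t) \<in> alg_cong R X E"
| sym: "(t, u) \<in> alg_cong R X E \<Longrightarrow> (u, t) \<in> alg_cong R X E"
| trans: "(t, u) \<in> alg_cong R X E \<Longrightarrow> (u, w) \<in> alg_cong R X E \<Longrightarrow> (t, w) \<in> alg_cong R X E"
| plus_cong: "(t, t') \<in> alg_cong R X E \<Longrightarrow> (u, u') \<in> alg_cong R X E
    \<Longrightarrow> (TPlus t u, TPlus t' u') \<in> alg_cong R X E"
| times_cong: "(t, t') \<in> alg_cong R X E \<Longrightarrow> (u, u') \<in> alg_cong R X E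
    \<Longrightarrow> (TTimes t u, TTimes t' u') \<in> alg_cong R X E"
| scale_cong: "c \<in> carrier R \<Longrightarrow> (t, t') \<in> alg_cong R X E
    \<Longrightarrow> (TScale c t, TScale c t') \<in> alg_cong R X E"
| plus_assoc: "t \<in> alg_terms R X \<Longrightarrow> u \<in> alg_terms R X \<Longrightarrow> w \<in> alg_terms R X
    \<Longrightarrow> (TPlus (TPlus t u) w, TPlus t (TPlus u w)) \<in> alg_cong R X E"
| plus_comm: "t \<in> alg_terms R X \<Longrightarrow> u \<in> alg_terms R X
    \<Longrightarrow> (TPlus t u, TPlus u t) \<in> alg_cong R X E"
| plus_zero: "t \<in> alg_terms R X \<Longrightarrow> (TPlus TZero t, t) \<in> alg_cong R X E"
| plus_inv: "t \<in> alg_terms R X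
    \<Longrightarrow> (TPlus (TScale (\<ominus>\<^bsub>R\<^esub> \<one>\<^bsub>R\<^esub>) t) t, TZero) \<in> alg_cong R X E"
| times_assoc: "t \<in> alg_terms R X \<Longrightarrow> u \<in> alg_terms R X \<Longrightarrow> w \<in> alg_terms R X
    \<Longrightarrow> (TTimes (TTimes t u) w, TTimes t (TTimes u w)) \<in> alg_cong R X E"
| distr_l: "t \<in> alg_terms R X \<Longrightarrow> u \<in> alg_terms R X \<Longrightarrow> w \<in> alg_terms R X
    \<Longrightarrow> (TTimes (TPlus t u) w, TPlus (TTimes t w) (TTimes u w)) \<in> alg_cong R X E"
| distr_r: "t \<in> alg_terms R X \<Longrightarrow> u \<in> alg_terms R X \<Longrightarrow> w \<in> alg_terms R X
    \<Longrightarrow> (TTimes t (TPlus u w), TPlus (TTimes t u) (TTimes t w)) \<in> alg_cong R X E"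
| scale_distr_l: "a \<in> carrier R \<Longrightarrow> b \<in> carrier R \<Longrightarrow> t \<in> alg_terms R X
    \<Longrightarrow> (TScale (a \<oplus>\<^bsub>R\<^esub> b) t, TPlus (TScale a t) (TScale b t)) \<in> alg_cong R X E"
| scale_distr_r: "a \<in> carrier R \<Longrightarrow> t \<in> alg_terms R X \<Longrightarrow> u \<in> alg_terms R X
    \<Longrightarrow> (TScale a (TPlus t u), TPlus (TScale a t) (TScale a u)) \<in> alg_cong R X E"
| scale_assoc: "a \<in> carrier R \<Longrightarrow> b \<in> carrier R \<Longrightarrow> t \<in> alg_terms R X
    \<Longrightarrow> (TScale (a \<otimes>\<^bsub>R\<^esub> b) t, TScale a (TScale b t)) \<in> alg_cong R X E"
| scale_one: "t \<in> alg_terms R X \<Longrightarrow> (TScale \<one>\<^bsub>R\<^esub> t, t) \<in> alg_cong R X E"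
| scale_times_l: "a \<in> carrier R \<Longrightarrow> t \<in> alg_terms R X \<Longrightarrow> u \<in> alg_terms R X
    \<Longrightarrow> (TTimes (TScale a t) u, TScale a (TTimes t u)) \<in> alg_cong R X E"
| scale_times_r: "a \<in> carrier R \<Longrightarrow> t \<in> alg_terms R X \<Longrightarrow> u \<in> alg_terms R X
    \<Longrightarrow> (TTimes t (TScale a u), TScale a (TTimes t u)) \<in> alg_cong R X E"

definition presented_algebra ::
  "('r, 'm) ring_scheme \<Rightarrow> 'g set \<Rightarrow> (('r, 'g) alg_term \<times> ('r, 'g) alg_term) set
    \<Rightarrow> ('r, ('r, 'g) alg_term set) module" where
  "presented_algebra R X E = \<lparr>
     carrier = alg_terms R X // alg_cong R X E,
     mult = (\<lambda>P Q. \<Union>t\<in>P. \<Union>u\<in>Q. alg_cong R X E `` {TTimes t u}),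
     one = undefined,
     zero = alg_cong R X E `` {TZero},
     add = (\<lambda>P Q. \<Union>t\<in>P. \<Union>u\<in>Q. alg_cong R X E `` {TPlus t u}),
     smult = (\<lambda>c P. \<Union>t\<in>P. alg_cong R X E `` {TScale c t})\<rparr>"

definition presented_gen ::
  "('r, 'm) ring_scheme \<Rightarrow> 'g set \<Rightarrow> (('r, 'g) alg_term \<times> ('r, 'g) alg_term) set
    \<Rightarrow> 'g \<Rightarrow> ('r, 'g) alg_term set" where
  "presented_gen R X E g = alg_cong R X E `` {TGen g}"

primrec eval_term :: "('r, 'b, 'k) module_scheme \<Rightarrow> ('g \<Rightarrow> 'b) \<Rightarrow> ('r, 'g) alg_term \<Rightarrow> 'b" where
  "eval_term B f (TGen g) = f g"
| "eval_term B f TZero = \<zero>\<^bsub>B\<^esub>"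
| "eval_term B f (TPlus t u) = eval_term B f t \<oplus>\<^bsub>B\<^esub> eval_term B f u"
| "eval_term B f (TTimes t u) = eval_term B f t \<otimes>\<^bsub>B\<^esub> eval_term B f u"
| "eval_term B f (TScale c t) = c \<odot>\<^bsub>B\<^esub> eval_term B f t"

lemma alg_cong_in_terms:
  assumes "cring R" and "(t, u) \<in> alg_cong R X E"
  shows "t \<in> alg_terms R X \<and> u \<in> alg_terms R X"
proof -
  interpret cring R by fact
  show ?thesis using assms(2) by (induction rule: alg_cong.induct) (auto intro: alg_terms.intros)
qed

lemma equiv_alg_cong:
  assumes "cring R"
  shows "equiv (alg_terms R X) (alg_cong R X E)"
proof (intro equivI refl_onI symI transI)
  show "alg_cong R X E \<subseteq> alg_terms R X \<times> alg_terms R X"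
    using alg_cong_in_terms[OF assms] by fast
qed (fact alg_cong.refl alg_cong.sym alg_cong.trans)+

lemma presented_algebra_ops:
  fixes R :: "('r, 'm) ring_scheme" and X :: "'g set" and E
  defines "C \<equiv> alg_cong R X E" and "A \<equiv> presented_algebra R X E"
  assumes "cring R"
  shows "\<lbrakk>t \<in> alg_terms R X; u \<in> alg_terms R X\<rbrakk> \<Longrightarrow> C `` {t} \<oplus>\<^bsub>A\<^esub> C `` {u} = C `` {TPlus t u}"
    and "\<lbrakk>t \<in> alg_terms R X; u \<in> alg_terms R X\<rbrakk> \<Longrightarrow> C `` {t} \<otimes>\<^bsub>A\<^esub> C `` {u} = C `` {TTimes t u}"
    and "\<lbrakk>c \<in> carrier R; t \<in> alg_terms R X\<rbrakk> \<Longrightarrow> c \<odot>\<^bsub>A\<^esub> C `` {t} = C `` {TScale c t}"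
    and "\<zero>\<^bsub>A\<^esub> = C `` {TZero}"
    and "carrier A = (\<lambda>t. C `` {t}) ` alg_terms R X"
proof -
  note eq = equiv_alg_cong[OF \<open>cring R\<close>, of X E]
  have p: "congruent2 C C (\<lambda>t u. C `` {TPlus t u})"
    unfolding C_def by (rule congruent2I') (rule equiv_class_eq[OF eq alg_cong.plus_cong])
  have m: "congruent2 C C (\<lambda>t u. C `` {TTimes t u})"
    unfolding C_def by (rule congruent2I') (rule equiv_class_eq[OF eq alg_cong.times_cong])
  have s: "congruent C (\<lambda>t. C `` {TScale c t})" if "c \<in> carrier R" for c
    unfolding C_def by (rule congruentI) (rule equiv_class_eq[OF eq alg_cong.scale_cong[OF that]])
  note eq' = eq[folded C_def]
  show "\<lbrakk>t \<in> alg_terms R X; u \<in> alg_terms R X\<rbrakk> \<Longrightarrow> C `` {t} \<oplus>\<^bsub>A\<^esub> C `` {u} = C `` {TPlus t u}"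
    using UN_equiv_class2[OF eq' eq' p] by (simp add: A_def presented_algebra_def C_def)
  show "\<lbrakk>t \<in> alg_terms R X; u \<in> alg_terms R X\<rbrakk> \<Longrightarrow> C `` {t} \<otimes>\<^bsub>A\<^esub> C `` {u} = C `` {TTimes t u}"
    using UN_equiv_class2[OF eq' eq' m] by (simp add: A_def presented_algebra_def C_def)
  show "\<lbrakk>c \<in> carrier R; t \<in> alg_terms R X\<rbrakk> \<Longrightarrow> c \<odot>\<^bsub>A\<^esub> C `` {t} = C `` {TScale c t}"
    using UN_equiv_class[OF eq' s] by (simp add: A_def presented_algebra_def C_def)
  show "\<zero>\<^bsub>A\<^esub> = C `` {TZero}" by (simp add: A_def presented_algebra_def C_def)
  show "carrier A = (\<lambda>t. C `` {t}) ` alg_terms R X"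
    by (auto simp: A_def presented_algebra_def C_def quotient_def)
qed

lemma assoc_algebra_presented:
  assumes "cring R"
  shows "assoc_algebra R (presented_algebra R X E)"
proof -
  interpret cring R by fact
  note ops = presented_algebra_ops[OF assms, where X = X and E = E]
  note simps = ops alg_terms.intros
  note eqs = alg_cong.intros(8-)[THEN equiv_class_eq[OF equiv_alg_cong[OF assms, of X E]]]
  have ab: "abelian_group (presented_algebra R X E)"
  proof (rule abelian_groupI, goal_cases)
    case (6 x)
    then obtain t where t: "t \<in> alg_terms R X" "x = alg_cong R X E `` {t}" by (auto simp: ops)
    then show ?case
      by (intro bexI[of _ "alg_cong R X E `` {TScale (\<ominus>\<^bsub>R\<^esub> \<one>\<^bsub>R\<^esub>) t}"])
         (simp_all add: simps eqs(4))
  next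
    case (4 x y)
    then show ?case by (auto simp only: simps eqs(2))
  qed (auto simp only: simps eqs(1,3))
  have "module R (presented_algebra R X E)"
  proof (rule moduleI[OF assms ab], goal_cases)
    case (5 x)
    then obtain t where t: "t \<in> alg_terms R X" "x = alg_cong R X E `` {t}" by (auto simp: ops)
    then show ?case using ops(3)[OF one_closed t(1)] eqs(11)[OF t(1)] by simp
  qed (auto simp only: simps eqs(8-10) a_closed m_closed)
  then show ?thesis
    by (intro assoc_algebra.intro assoc_algebra_axioms.intro)
       (auto simp only: simps eqs(5-7,12-13))
qed

lemma presented_relation:
  assumes "cring R" and "(t, u) \<in> E" and "t \<in> alg_terms R X" and "u \<in> alg_terms R X"
  shows "eval_term (presented_algebra R X E) (presented_gen R X E) t =
         eval_term (presented_algebra R X E) (presented_gen R X E) u"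
proof -
  have ev: "eval_term (presented_algebra R X E) (presented_gen R X E) w = alg_cong R X E `` {w}"
    if "w \<in> alg_terms R X" for w
    using that
    by (induction rule: alg_terms.induct)
       (auto simp: presented_gen_def presented_algebra_ops[OF assms(1)])
  show ?thesis
    using assms
    by (simp add: ev equiv_class_eq[OF equiv_alg_cong[OF assms(1)]] alg_cong.relation)
qed

lemma presented_algebra_universal:
  assumes B: "assoc_algebra R B"
    and f: "f \<in> X \<rightarrow> carrier B"
    and rels: "\<And>t u. \<lbrakk>(t, u) \<in> E; t \<in> alg_terms R X; u \<in> alg_terms R X\<rbrakk>
                 \<Longrightarrow> eval_term B f t = eval_term B f u"
  shows "\<exists>h \<in> alg_hom R (presented_algebra R X E) B. \<forall>g\<in>X. h (presented_gen R X E g) = f g"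
proof -
  interpret B: assoc_algebra R B by fact
  have cr: "cring R" by (rule B.R.is_cring)
  note ops = presented_algebra_ops[OF cr, where X = X and E = E]
  note carr = presented_algebra_ops(5)[OF cr, of X E]
  have closed: "eval_term B f t \<in> carrier B" if "t \<in> alg_terms R X" for t
    using that f by induction (auto intro: B.mult_closed)
  have resp: "eval_term B f t = eval_term B f u" if "(t, u) \<in> alg_cong R X E" for t u
    using that
  proof (induction rule: alg_cong.induct)
    case (plus_inv t)
    then show ?case
      using B.smult_l_minus[of "\<one>\<^bsub>R\<^esub>" "eval_term B f t"] closed[of t] by (simp add: B.M.l_neg)
  next
    case (plus_comm t u)
    then show ?case by (simp add: closed B.M.a_comm)
  qed (simp_all add: rels closed B.M.a_assoc B.mult_assoc B.mult_l_distr B.mult_r_distr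
        B.smult_l_distr B.smult_r_distr B.smult_assoc1 B.smult_mult_l B.smult_mult_r)
  define h where "h P = (THE b. \<exists>t\<in>P. b = eval_term B f t)" for P
  have h: "h (alg_cong R X E `` {t}) = eval_term B f t" if "t \<in> alg_terms R X" for t
    unfolding h_def using that
    by (intro the_equality) (auto intro: alg_cong.refl dest: resp)
  have "h \<in> alg_hom R (presented_algebra R X E) B"
    by (auto simp: alg_hom_def carr ops h alg_terms.intros closed)
  moreover have "\<forall>g\<in>X. h (presented_gen R X E g) = f g"
    by (auto simp: presented_gen_def h alg_terms.gen)
  ultimately show ?thesis by blast
qed

lemma presented_algebra_hom_unique:
  assumes "assoc_algebra R B"
    and h: "h \<in> alg_hom R (presented_algebra R X E) B"
    and k: "k \<in> alg_hom R (presented_algebra R X E) B"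
    and gens: "\<And>g. g \<in> X \<Longrightarrow> h (presented_gen R X E g) = k (presented_gen R X E g)"
    and x: "x \<in> carrier (presented_algebra R X E)"
  shows "h x = k x"
proof -
  interpret B: assoc_algebra R B by fact
  have cr: "cring R" by (rule B.R.is_cring)
  interpret A: assoc_algebra R "presented_algebra R X E" by (rule assoc_algebra_presented[OF cr])
  have hom_zero: "j \<zero>\<^bsub>presented_algebra R X E\<^esub> = \<zero>\<^bsub>B\<^esub>"
    if j: "j \<in> alg_hom R (presented_algebra R X E) B" for j
  proof -
    have "j (\<zero>\<^bsub>R\<^esub> \<odot>\<^bsub>presented_algebra R X E\<^esub> \<zero>\<^bsub>presented_algebra R X E\<^esub>)
        = \<zero>\<^bsub>R\<^esub> \<odot>\<^bsub>B\<^esub> j \<zero>\<^bsub>presented_algebra R X E\<^esub>"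
      using j A.M.zero_closed B.R.zero_closed unfolding alg_hom_def by blast
    moreover have "j \<zero>\<^bsub>presented_algebra R X E\<^esub> \<in> carrier B"
      using j by (auto simp: alg_hom_def)
    ultimately show ?thesis by simp
  qed
  have cls: "alg_cong R X E `` {t} \<in> carrier (presented_algebra R X E)" if "t \<in> alg_terms R X" for t
    using that by (auto simp: presented_algebra_ops(5)[OF cr])
  have "h (alg_cong R X E `` {t}) = k (alg_cong R X E `` {t})" if "t \<in> alg_terms R X" for t
    using that
  proof (induction rule: alg_terms.induct)
    case (gen g)
    then show ?case using gens by (simp add: presented_gen_def)
  next
    case zero
    then show ?case using hom_zero[OF h] hom_zero[OF k] by (simp add: presented_algebra_ops(4)[OF cr])
  next
    case (plus t u)
    then show ?case
      using h k cls[of t] cls[of u]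
      by (simp add: alg_hom_def flip: presented_algebra_ops(1)[OF cr])
  next
    case (times t u)
    then show ?case
      using h k cls[of t] cls[of u]
      by (simp add: alg_hom_def flip: presented_algebra_ops(2)[OF cr])
  next
    case (scale c t)
    then show ?case
      using h k cls[of t] by (simp add: alg_hom_def flip: presented_algebra_ops(3)[OF cr])
  qed
  then show ?thesis using x by (auto simp: presented_algebra_ops(5)[OF cr])
qed


section \<open>Leavitt path algebras of ultragraphs\<close>

datatype ('v, 'e) lpa_gen = GenP "'v set" | GenS 'e | GenSstar 'e

definition lpa_gens :: "('v, 'e) ultragraph \<Rightarrow> ('v, 'e) lpa_gen set" where
  "lpa_gens G = GenP ` gen_verts G \<union> GenS ` edges G \<union> GenSstar ` edges G"

abbreviation tP :: "'v set \<Rightarrow> ('r, ('v, 'e) lpa_gen) alg_term" where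
  "tP A \<equiv> TGen (GenP A)"
abbreviation tS :: "'e \<Rightarrow> ('r, ('v, 'e) lpa_gen) alg_term" where
  "tS e \<equiv> TGen (GenS e)"
abbreviation tSstar :: "'e \<Rightarrow> ('r, ('v, 'e) lpa_gen) alg_term" where
  "tSstar e \<equiv> TGen (GenSstar e)"

text \<open>
  Formal sums are ordered, so \<open>ck\<close> lists the finitely many edges leaving \<open>v\<close> without repetition, in
  any order.
\<close>

inductive_set lpa_rels ::
  "('r, 'm) ring_scheme \<Rightarrow> ('v, 'e) ultragraph \<Rightarrow>
    (('r, ('v, 'e) lpa_gen) alg_term \<times> ('r, ('v, 'e) lpa_gen) alg_term) set"
  for R :: "('r, 'm) ring_scheme" and G :: "('v, 'e) ultragraph" where
  empty: "(tP {}, TZero) \<in> lpa_rels R G"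
| inter: "A \<in> gen_verts G \<Longrightarrow> B \<in> gen_verts G
    \<Longrightarrow> (TTimes (tP A) (tP B), tP (A \<inter> B)) \<in> lpa_rels R G"
| union: "A \<in> gen_verts G \<Longrightarrow> B \<in> gen_verts G
    \<Longrightarrow> (tP (A \<union> B), TPlus (TPlus (tP A) (tP B)) (TScale (\<ominus>\<^bsub>R\<^esub> \<one>\<^bsub>R\<^esub>) (tP (A \<inter> B))))
        \<in> lpa_rels R G"
| src_S: "e \<in> edges G \<Longrightarrow> (TTimes (tP {src G e}) (tS e), tS e) \<in> lpa_rels R G"
| S_rng: "e \<in> edges G \<Longrightarrow> (TTimes (tS e) (tP (rng G e)), tS e) \<in> lpa_rels R G"
| rng_Sstar: "e \<in> edges G \<Longrightarrow> (TTimes (tP (rng G e)) (tSstar e), tSstar e) \<in> lpa_rels R G"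
| Sstar_src: "e \<in> edges G \<Longrightarrow> (TTimes (tSstar e) (tP {src G e}), tSstar e) \<in> lpa_rels R G"
| Sstar_S: "e \<in> edges G \<Longrightarrow> f \<in> edges G
    \<Longrightarrow> (TTimes (tSstar e) (tS f), if e = f then tP (rng G e) else TZero) \<in> lpa_rels R G"
| ck: "v \<in> verts G \<Longrightarrow> distinct es \<Longrightarrow> set es = out_edges G v \<Longrightarrow> es \<noteq> []
    \<Longrightarrow> (tP {v}, foldr (\<lambda>e t. TPlus (TTimes (tS e) (tSstar e)) t) es TZero) \<in> lpa_rels R G"

lemma lpa_rels_in_terms:
  assumes "cring R" and "ultragraph G" and "(t, u) \<in> lpa_rels R G"
  shows "t \<in> alg_terms R (lpa_gens G) \<and> u \<in> alg_terms R (lpa_gens G)"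
proof -
  interpret cring R by fact
  interpret ultragraph G by fact
  have sums: "foldr (\<lambda>e t. TPlus (TTimes (tS e) (tSstar e)) t) es TZero \<in> alg_terms R (lpa_gens G)"
    if "set es \<subseteq> edges G" for es
    using that by (induction es) (auto intro!: alg_terms.intros simp: lpa_gens_def)
  have gens: "GenP A \<in> lpa_gens G \<longleftrightarrow> A \<in> gen_verts G" "GenS e \<in> lpa_gens G \<longleftrightarrow> e \<in> edges G"
    "GenSstar e \<in> lpa_gens G \<longleftrightarrow> e \<in> edges G" for A e
    by (auto simp: lpa_gens_def)
  show ?thesis
    using assms(3)
    by cases (auto intro!: alg_terms.intros sums gen_verts.range gen_verts.singleton src_in_verts
          simp: gens gen_verts_empty gen_verts_Un gen_verts_Int out_edges_def)
qed

definition leavitt_path_algebra ::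
  "('r, 'm) ring_scheme \<Rightarrow> ('v, 'e) ultragraph
    \<Rightarrow> ('r, ('r, ('v, 'e) lpa_gen) alg_term set) module" where
  "leavitt_path_algebra R G = presented_algebra R (lpa_gens G) (lpa_rels R G)"

definition lpa_p where "lpa_p R G A = presented_gen R (lpa_gens G) (lpa_rels R G) (GenP A)"
definition lpa_s where "lpa_s R G e = presented_gen R (lpa_gens G) (lpa_rels R G) (GenS e)"
definition lpa_sstar where
  "lpa_sstar R G e = presented_gen R (lpa_gens G) (lpa_rels R G) (GenSstar e)"


section \<open>Free modules\<close>

definition free_module :: "('r, 'm) ring_scheme \<Rightarrow> 'b set \<Rightarrow> ('r, 'b \<Rightarrow> 'r) module" where
  "free_module R B = \<lparr>
     carrier = {x \<in> B \<rightarrow>\<^sub>E carrier R. finite {b \<in> B. x b \<noteq> \<zero>\<^bsub>R\<^esub>}},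
     mult = undefined,
     one = undefined,
     zero = (\<lambda>b\<in>B. \<zero>\<^bsub>R\<^esub>),
     add = (\<lambda>x y. \<lambda>b\<in>B. x b \<oplus>\<^bsub>R\<^esub> y b),
     smult = (\<lambda>c x. \<lambda>b\<in>B. c \<otimes>\<^bsub>R\<^esub> x b)\<rparr>"

definition basis_vec :: "('r, 'm) ring_scheme \<Rightarrow> 'b set \<Rightarrow> 'b \<Rightarrow> ('b \<Rightarrow> 'r)" where
  "basis_vec R B b = (\<lambda>b'\<in>B. if b' = b then \<one>\<^bsub>R\<^esub> else \<zero>\<^bsub>R\<^esub>)"

definition lin_ext ::
  "('r, 'm) ring_scheme \<Rightarrow> 'b set \<Rightarrow> ('r, 'a, 'n) module_scheme \<Rightarrow> ('b \<Rightarrow> 'a)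
    \<Rightarrow> ('b \<Rightarrow> 'r) \<Rightarrow> 'a" where
  "lin_ext R B M T =
     (\<lambda>x\<in>carrier (free_module R B). finsum M (\<lambda>b. x b \<odot>\<^bsub>M\<^esub> T b) {b \<in> B. x b \<noteq> \<zero>\<^bsub>R\<^esub>})"

lemma module_free_module:
  assumes "cring R"
  shows "module R (free_module R B)"
proof -
  interpret cring R by fact
  have fin: "finite {b \<in> B. x b \<oplus>\<^bsub>R\<^esub> y b \<noteq> \<zero>\<^bsub>R\<^esub>}"
    if "finite {b \<in> B. x b \<noteq> \<zero>\<^bsub>R\<^esub>}" "finite {b \<in> B. y b \<noteq> \<zero>\<^bsub>R\<^esub>}" for x y
    by (rule finite_subset[OF _ finite_UnI[OF that]]) auto
  have fins: "finite {b \<in> B. c \<otimes>\<^bsub>R\<^esub> x b \<noteq> \<zero>\<^bsub>R\<^esub>}"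
    if "finite {b \<in> B. x b \<noteq> \<zero>\<^bsub>R\<^esub>}" "c \<in> carrier R" for x c
    by (rule finite_subset[OF _ that(1)]) (use that in auto)
  have finm: "finite {b \<in> B. \<ominus>\<^bsub>R\<^esub> x b \<noteq> \<zero>\<^bsub>R\<^esub>}"
    if "finite {b \<in> B. x b \<noteq> \<zero>\<^bsub>R\<^esub>}" for x
    by (rule finite_subset[OF _ that]) auto
  have ab: "abelian_group (free_module R B)"
  proof (rule abelian_groupI, goal_cases)
    case (6 x)
    then show ?case
      by (intro bexI[of _ "\<lambda>b\<in>B. \<ominus>\<^bsub>R\<^esub> x b"])
         (auto simp: free_module_def PiE_iff l_neg finm cong: conj_cong)
  qed (auto simp: free_module_def PiE_iff fin a_ac extensional_def fun_eq_iff cong: conj_cong)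
  show ?thesis
    by (rule moduleI[OF assms ab])
       (auto simp: free_module_def PiE_iff fins extensional_def fun_eq_iff l_distr r_distr m_ac
         cong: conj_cong)
qed

lemma lin_ext_basis_vec:
  assumes "module R M" and b: "b \<in> B" and T: "T b \<in> carrier M"
  shows "lin_ext R B M T (basis_vec R B b) = T b"
proof -
  interpret module R M by fact
  have carr: "basis_vec R B b \<in> carrier (free_module R B)"
    using b by (auto simp: free_module_def basis_vec_def cong: conj_cong)
  show ?thesis
  proof (cases "\<one>\<^bsub>R\<^esub> = \<zero>\<^bsub>R\<^esub>")
    case True
    have "T b = \<one>\<^bsub>R\<^esub> \<odot>\<^bsub>M\<^esub> T b" using T by simp
    also have "\<dots> = \<zero>\<^bsub>M\<^esub>" unfolding True using T by simp
    finally have "T b = \<zero>\<^bsub>M\<^esub>" .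
    moreover have "{b' \<in> B. basis_vec R B b b' \<noteq> \<zero>\<^bsub>R\<^esub>} = {}"
      using True by (auto simp: basis_vec_def)
    ultimately show ?thesis using carr by (simp only: lin_ext_def restrict_apply M.finsum_empty if_True)
  next
    case False
    then have "{b' \<in> B. basis_vec R B b b' \<noteq> \<zero>\<^bsub>R\<^esub>} = {b}"
      using b by (auto simp: basis_vec_def)
    then show ?thesis using carr b T by (simp add: lin_ext_def basis_vec_def)
  qed
qed


section \<open>The path module\<close>

text \<open>
  \<open>FinPath es v\<close> is the pair of the finite path \<open>es\<close> and the sink \<open>v\<close>; \<open>FinPath [] v\<close> stands for the
  pair \<open>(v, v)\<close>.
\<close>

datatype ('v, 'e) upath = FinPath "'e list" 'v | InfPath "nat \<Rightarrow> 'e"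

definition is_finite_path :: "('v, 'e) ultragraph \<Rightarrow> 'e list \<Rightarrow> bool" where
  "is_finite_path G es \<longleftrightarrow> es \<noteq> [] \<and> set es \<subseteq> edges G \<and>
     (\<forall>i. Suc i < length es \<longrightarrow> src G (es ! Suc i) \<in> rng G (es ! i))"

definition sink_paths :: "('v, 'e) ultragraph \<Rightarrow> ('v, 'e) upath set" where
  "sink_paths G =
     {FinPath es v | es v. is_finite_path G es \<and> v \<in> rng G (last es) \<inter> sinks G} \<union>
     {FinPath [] v | v. v \<in> sinks G}"

definition infinite_paths :: "('v, 'e) ultragraph \<Rightarrow> ('v, 'e) upath set" where
  "infinite_paths G =
     {InfPath f | f. (\<forall>i. f i \<in> edges G) \<and> (\<forall>i. src G (f (Suc i)) \<in> rng G (f i))}"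

definition path_basis :: "('v, 'e) ultragraph \<Rightarrow> ('v, 'e) upath set" where
  "path_basis G = sink_paths G \<union> infinite_paths G"

fun path_src :: "('v, 'e) ultragraph \<Rightarrow> ('v, 'e) upath \<Rightarrow> 'v" where
  "path_src G (FinPath [] v) = v"
| "path_src G (FinPath (e # es) v) = src G e"
| "path_src G (InfPath f) = src G (f 0)"

fun path_cons :: "'e \<Rightarrow> ('v, 'e) upath \<Rightarrow> ('v, 'e) upath" where
  "path_cons e (FinPath es v) = FinPath (e # es) v"
| "path_cons e (InfPath f) = InfPath (case_nat e f)"

fun first_edge :: "('v, 'e) upath \<Rightarrow> 'e option" where
  "first_edge (FinPath [] v) = None"
| "first_edge (FinPath (e # es) v) = Some e"
| "first_edge (InfPath f) = Some (f 0)"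

fun path_tl :: "('v, 'e) upath \<Rightarrow> ('v, 'e) upath" where
  "path_tl (FinPath es v) = FinPath (tl es) v"
| "path_tl (InfPath f) = InfPath (\<lambda>i. f (Suc i))"

definition path_module ::
  "('r, 'm) ring_scheme \<Rightarrow> ('v, 'e) ultragraph \<Rightarrow> ('r, ('v, 'e) upath \<Rightarrow> 'r) module" where
  "path_module R G = free_module R (path_basis G)"

definition path_vec ::
  "('r, 'm) ring_scheme \<Rightarrow> ('v, 'e) ultragraph \<Rightarrow> ('v, 'e) upath \<Rightarrow> (('v, 'e) upath \<Rightarrow> 'r)" where
  "path_vec R G \<alpha> = basis_vec R (path_basis G) \<alpha>"

definition op_P ::
  "('r, 'm) ring_scheme \<Rightarrow> ('v, 'e) ultragraph \<Rightarrow> 'v set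
    \<Rightarrow> (('v, 'e) upath \<Rightarrow> 'r) \<Rightarrow> (('v, 'e) upath \<Rightarrow> 'r)" where
  "op_P R G A = lin_ext R (path_basis G) (path_module R G)
     (\<lambda>\<alpha>. if path_src G \<alpha> \<in> A then path_vec R G \<alpha> else \<zero>\<^bsub>path_module R G\<^esub>)"

definition op_S ::
  "('r, 'm) ring_scheme \<Rightarrow> ('v, 'e) ultragraph \<Rightarrow> 'e
    \<Rightarrow> (('v, 'e) upath \<Rightarrow> 'r) \<Rightarrow> (('v, 'e) upath \<Rightarrow> 'r)" where
  "op_S R G e = lin_ext R (path_basis G) (path_module R G)
     (\<lambda>\<alpha>. if path_src G \<alpha> \<in> rng G e then path_vec R G (path_cons e \<alpha>)
          else \<zero>\<^bsub>path_module R G\<^esub>)"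

definition op_Sstar ::
  "('r, 'm) ring_scheme \<Rightarrow> ('v, 'e) ultragraph \<Rightarrow> 'e
    \<Rightarrow> (('v, 'e) upath \<Rightarrow> 'r) \<Rightarrow> (('v, 'e) upath \<Rightarrow> 'r)" where
  "op_Sstar R G e = lin_ext R (path_basis G) (path_module R G)
     (\<lambda>\<alpha>. if first_edge \<alpha> = Some e then path_vec R G (path_tl \<alpha>)
          else \<zero>\<^bsub>path_module R G\<^esub>)"

end

theory Submission
  imports Defs
begin

text \<open>
  By the universal property of the presented algebra, it suffices to check that the operators
  \<open>op_P\<close>, \<open>op_S\<close> and \<open>op_Sstar\<close> are linear endomorphisms of the path module and satisfy the
  defining relations (\<open>lpa_op_in_End\<close>, \<open>eval_lpa_rels\<close>). Both sides of a relation are linear, and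
  linear maps on a free module are determined by their values on the basis
  (\<open>End_free_module_eqI\<close>), so a relation can be tested on one basis path \<open>\<alpha>\<close> at a time. There \<open>op_P\<close>
  tests the source of \<open>\<alpha>\<close>, \<open>op_S\<close> prepends an edge and \<open>op_Sstar\<close> removes the first edge; where the
  test fails or no edge can be prepended or removed, the result is zero.

  Three facts about paths carry the verification: the basis is stable under prepending an edge whose
  range contains the source (\<open>path_cons_in_basis\<close>); a path with a first edge \<open>e\<close> starts at the source
  of \<open>e\<close>, and its tail is a basis path that starts in the range of \<open>e\<close> (\<open>first_edge_in_basis\<close>); and
  a basis path without a first edge starts at a sink (\<open>first_edge_None_in_basis\<close>). The last fact is
  what makes the Cuntz-Krieger relation hold: a basis path that starts at a vertex \<open>v\<close> emitting edges
  has one of these as its first edge, so exactly one summand \<open>S\<^sub>e S\<^sub>e\<^sup>*\<close> fixes the corresponding basis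
  vector and all the others kill it.
\<close>

section \<open>Linear maps on free modules\<close>

lemma basis_vec_carrier:
  assumes "cring R"
  shows "basis_vec R B b \<in> carrier (free_module R B)"
proof -
  interpret cring R by fact
  have "finite {b' \<in> B. basis_vec R B b b' \<noteq> \<zero>\<^bsub>R\<^esub>}"
    by (rule finite_subset[of _ "{b}"]) (auto simp: basis_vec_def split: if_splits)
  then show ?thesis by (auto simp: free_module_def basis_vec_def)
qed

text \<open>
  Linearity of \<open>lin_ext\<close> is not immediate, because the sum defining it ranges over
  the support of the argument and supports change under addition and scaling. Enlarging the index set
  by basis elements with coefficient zero lets several vectors share one index set.
\<close>

lemma lin_ext_superset:
  assumes "module R M" and T: "T \<in> B \<rightarrow> carrier M"
    and x: "x \<in> carrier (free_module R B)"
    and S: "finite S" "S \<subseteq> B" "{b \<in> B. x b \<noteq> \<zero>\<^bsub>R\<^esub>} \<subseteq> S"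
  shows "lin_ext R B M T x = finsum M (\<lambda>b. x b \<odot>\<^bsub>M\<^esub> T b) S"
proof -
  interpret module R M by fact
  have xc: "x b \<in> carrier R" if "b \<in> B" for b
    using x that by (auto simp: free_module_def)
  have "finsum M (\<lambda>b. x b \<odot>\<^bsub>M\<^esub> T b) {b \<in> B. x b \<noteq> \<zero>\<^bsub>R\<^esub>} = finsum M (\<lambda>b. x b \<odot>\<^bsub>M\<^esub> T b) S"
    using S T xc by (intro M.add.finprod_mono_neutral_cong_left) (auto simp: Pi_iff subset_iff)
  then show ?thesis using x by (simp add: lin_ext_def)
qed

lemma lin_ext_closed:
  assumes "module R M" and T: "T \<in> B \<rightarrow> carrier M"
    and x: "x \<in> carrier (free_module R B)"
  shows "lin_ext R B M T x \<in> carrier M"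
proof -
  interpret module R M by fact
  show ?thesis
    using x T by (auto simp: lin_ext_def free_module_def PiE_iff Pi_iff intro!: M.finsum_closed)
qed

lemma lin_ext_add:
  assumes "module R M" and T: "T \<in> B \<rightarrow> carrier M"
    and x: "x \<in> carrier (free_module R B)" and y: "y \<in> carrier (free_module R B)"
  shows "lin_ext R B M T (x \<oplus>\<^bsub>free_module R B\<^esub> y) = lin_ext R B M T x \<oplus>\<^bsub>M\<^esub> lin_ext R B M T y"
proof -
  interpret module R M by fact
  interpret F: module R "free_module R B" by (rule module_free_module[OF R.is_cring])
  define S where "S = {b \<in> B. x b \<noteq> \<zero>\<^bsub>R\<^esub>} \<union> {b \<in> B. y b \<noteq> \<zero>\<^bsub>R\<^esub>}"
  have S: "finite S" "S \<subseteq> B" using x y by (auto simp: S_def free_module_def)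
  have c: "x b \<in> carrier R" "y b \<in> carrier R" "T b \<in> carrier M" if "b \<in> S" for b
    using x y T S that by (auto simp: free_module_def Pi_iff)
  have add: "(x \<oplus>\<^bsub>free_module R B\<^esub> y) b = x b \<oplus>\<^bsub>R\<^esub> y b" if "b \<in> B" for b
    using that by (simp add: free_module_def)
  have "lin_ext R B M T (x \<oplus>\<^bsub>free_module R B\<^esub> y)
      = finsum M (\<lambda>b. (x \<oplus>\<^bsub>free_module R B\<^esub> y) b \<odot>\<^bsub>M\<^esub> T b) S"
    by (rule lin_ext_superset[OF assms(1) T F.a_closed[OF x y] S]) (auto simp: S_def add)
  also have "\<dots> = finsum M (\<lambda>b. x b \<odot>\<^bsub>M\<^esub> T b \<oplus>\<^bsub>M\<^esub> y b \<odot>\<^bsub>M\<^esub> T b) S"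
    using S c by (intro M.finsum_cong') (auto simp: add subset_iff smult_l_distr)
  also have "\<dots> = finsum M (\<lambda>b. x b \<odot>\<^bsub>M\<^esub> T b) S \<oplus>\<^bsub>M\<^esub> finsum M (\<lambda>b. y b \<odot>\<^bsub>M\<^esub> T b) S"
    using c by (intro M.finsum_addf) auto
  also have "\<dots> = lin_ext R B M T x \<oplus>\<^bsub>M\<^esub> lin_ext R B M T y"
    using lin_ext_superset[OF assms(1) T x S] lin_ext_superset[OF assms(1) T y S]
    by (simp add: S_def)
  finally show ?thesis .
qed

lemma lin_ext_smult:
  assumes "module R M" and T: "T \<in> B \<rightarrow> carrier M"
    and c: "c \<in> carrier R" and x: "x \<in> carrier (free_module R B)"
  shows "lin_ext R B M T (c \<odot>\<^bsub>free_module R B\<^esub> x) = c \<odot>\<^bsub>M\<^esub> lin_ext R B M T x"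
proof -
  interpret module R M by fact
  interpret F: module R "free_module R B" by (rule module_free_module[OF R.is_cring])
  define S where "S = {b \<in> B. x b \<noteq> \<zero>\<^bsub>R\<^esub>}"
  have S: "finite S" "S \<subseteq> B" using x by (auto simp: S_def free_module_def)
  have cl: "x b \<in> carrier R" "T b \<in> carrier M" if "b \<in> S" for b
    using x T S that by (auto simp: free_module_def Pi_iff)
  have sm: "(c \<odot>\<^bsub>free_module R B\<^esub> x) b = c \<otimes>\<^bsub>R\<^esub> x b" if "b \<in> B" for b
    using that by (simp add: free_module_def)
  have "lin_ext R B M T (c \<odot>\<^bsub>free_module R B\<^esub> x)
      = finsum M (\<lambda>b. (c \<odot>\<^bsub>free_module R B\<^esub> x) b \<odot>\<^bsub>M\<^esub> T b) S"
    by (rule lin_ext_superset[OF assms(1) T F.smult_closed[OF c x] S]) (auto simp: S_def sm c)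
  also have "\<dots> = finsum M (\<lambda>b. c \<odot>\<^bsub>M\<^esub> (x b \<odot>\<^bsub>M\<^esub> T b)) S"
    using S cl c by (intro M.finsum_cong') (auto simp: sm subset_iff smult_assoc1)
  also have "\<dots> = c \<odot>\<^bsub>M\<^esub> lin_ext R B M T x"
    using x S cl c finsum_smult_ldistr[of S c "\<lambda>b. x b \<odot>\<^bsub>M\<^esub> T b"]
    by (simp add: lin_ext_def S_def)
  finally show ?thesis .
qed

lemma lin_ext_in_End:
  assumes "cring R" and T: "T \<in> B \<rightarrow> carrier (free_module R B)"
  shows "lin_ext R B (free_module R B) T \<in> carrier (End_alg R (free_module R B))"
proof -
  note M = module_free_module[OF assms(1), of B]
  show ?thesis
    using lin_ext_closed[OF M T] lin_ext_add[OF M T] lin_ext_smult[OF M T]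
    by (auto simp: End_alg_def PiE_iff) (auto simp: lin_ext_def)
qed

text \<open>
  A vector of the free module is reduced to zero by splitting off one basis vector of its
  support at a time.
\<close>

lemma free_module_hom_eqI:
  assumes "cring R"
    and f_add: "\<And>x y. \<lbrakk>x \<in> carrier (free_module R B); y \<in> carrier (free_module R B)\<rbrakk>
      \<Longrightarrow> f (x \<oplus>\<^bsub>free_module R B\<^esub> y) = f x \<oplus>\<^bsub>M\<^esub> f y"
    and f_smult: "\<And>c x. \<lbrakk>c \<in> carrier R; x \<in> carrier (free_module R B)\<rbrakk>
      \<Longrightarrow> f (c \<odot>\<^bsub>free_module R B\<^esub> x) = c \<odot>\<^bsub>M\<^esub> f x"
    and g_add: "\<And>x y. \<lbrakk>x \<in> carrier (free_module R B); y \<in> carrier (free_module R B)\<rbrakk>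
      \<Longrightarrow> g (x \<oplus>\<^bsub>free_module R B\<^esub> y) = g x \<oplus>\<^bsub>M\<^esub> g y"
    and g_smult: "\<And>c x. \<lbrakk>c \<in> carrier R; x \<in> carrier (free_module R B)\<rbrakk>
      \<Longrightarrow> g (c \<odot>\<^bsub>free_module R B\<^esub> x) = c \<odot>\<^bsub>M\<^esub> g x"
    and zero: "f \<zero>\<^bsub>free_module R B\<^esub> = g \<zero>\<^bsub>free_module R B\<^esub>"
    and basis: "\<And>b. b \<in> B \<Longrightarrow> f (basis_vec R B b) = g (basis_vec R B b)"
    and x: "x \<in> carrier (free_module R B)"
  shows "f x = g x"
proof -
  interpret F: module R "free_module R B" by (rule module_free_module[OF assms(1)])
  have "f y = g y"
    if "finite S" "y \<in> carrier (free_module R B)" "{b \<in> B. y b \<noteq> \<zero>\<^bsub>R\<^esub>} \<subseteq> S" for S y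
    using that
  proof (induction S arbitrary: y)
    case empty
    then have "y = \<zero>\<^bsub>free_module R B\<^esub>"
      by (auto simp: free_module_def PiE_iff extensional_def fun_eq_iff)
    then show ?case using zero by simp
  next
    case (insert b S)
    show ?case
    proof (cases "b \<in> B")
      case False
      then show ?thesis using insert by blast
    next
      case True
      define z where "z = (\<lambda>b'\<in>B. if b' = b then \<zero>\<^bsub>R\<^esub> else y b')"
      have "finite {b' \<in> B. y b' \<noteq> \<zero>\<^bsub>R\<^esub>}" using insert.prems by (auto simp: free_module_def)
      then have "finite {b' \<in> B. z b' \<noteq> \<zero>\<^bsub>R\<^esub>}"
        by (rule rev_finite_subset) (auto simp: z_def split: if_splits)
      then have z: "z \<in> carrier (free_module R B)"
        using insert.prems(1) by (auto simp: free_module_def z_def PiE_iff)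
      have yb: "y b \<in> carrier R" using True insert.prems(1) by (auto simp: free_module_def)
      note bv = basis_vec_carrier[OF assms(1), of B b]
      have y: "y = y b \<odot>\<^bsub>free_module R B\<^esub> basis_vec R B b \<oplus>\<^bsub>free_module R B\<^esub> z"
        using insert.prems(1) yb
        by (auto simp: free_module_def z_def basis_vec_def PiE_iff extensional_def fun_eq_iff)
      have "{b' \<in> B. z b' \<noteq> \<zero>\<^bsub>R\<^esub>} \<subseteq> S"
        using insert.prems(2) by (auto simp: z_def split: if_splits)
      then have "f z = g z" using insert.IH z by blast
      moreover have "f (y b \<odot>\<^bsub>free_module R B\<^esub> basis_vec R B b \<oplus>\<^bsub>free_module R B\<^esub> z)
          = y b \<odot>\<^bsub>M\<^esub> f (basis_vec R B b) \<oplus>\<^bsub>M\<^esub> f z"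
        using yb bv z by (simp add: f_add f_smult)
      moreover have "g (y b \<odot>\<^bsub>free_module R B\<^esub> basis_vec R B b \<oplus>\<^bsub>free_module R B\<^esub> z)
          = y b \<odot>\<^bsub>M\<^esub> g (basis_vec R B b) \<oplus>\<^bsub>M\<^esub> g z"
        using yb bv z by (simp add: g_add g_smult)
      ultimately show ?thesis using basis[OF True] by (subst (1 2) y) simp
    qed
  qed
  then show ?thesis using x by (auto simp: free_module_def)
qed

lemma End_alg_apply:
  assumes "x \<in> carrier M"
  shows "(f \<otimes>\<^bsub>End_alg R M\<^esub> g) x = f (g x)"
    and "(f \<oplus>\<^bsub>End_alg R M\<^esub> g) x = f x \<oplus>\<^bsub>M\<^esub> g x"
    and "(c \<odot>\<^bsub>End_alg R M\<^esub> f) x = c \<odot>\<^bsub>M\<^esub> f x"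
    and "\<zero>\<^bsub>End_alg R M\<^esub> x = \<zero>\<^bsub>M\<^esub>"
  using assms by (simp_all add: End_alg_def compose_def)

lemma End_alg_apply_zero:
  assumes "module R M" and "f \<in> carrier (End_alg R M)"
  shows "f \<zero>\<^bsub>M\<^esub> = \<zero>\<^bsub>M\<^esub>"
proof -
  interpret module R M by fact
  have "f (\<zero>\<^bsub>R\<^esub> \<odot>\<^bsub>M\<^esub> \<zero>\<^bsub>M\<^esub>) = \<zero>\<^bsub>R\<^esub> \<odot>\<^bsub>M\<^esub> f \<zero>\<^bsub>M\<^esub>" and "f \<zero>\<^bsub>M\<^esub> \<in> carrier M"
    using assms(2) M.zero_closed R.zero_closed by (auto simp: End_alg_def simp del: smult_l_null smult_r_null)
  then show ?thesis by simp
qed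

lemma End_free_module_eqI:
  assumes "cring R"
    and f: "f \<in> carrier (End_alg R (free_module R B))"
    and g: "g \<in> carrier (End_alg R (free_module R B))"
    and basis: "\<And>b. b \<in> B \<Longrightarrow> f (basis_vec R B b) = g (basis_vec R B b)"
  shows "f = g"
proof
  fix x
  note M = module_free_module[OF assms(1), of B]
  show "f x = g x"
  proof (cases "x \<in> carrier (free_module R B)")
    case True
    then show ?thesis
    proof (rule free_module_hom_eqI[OF assms(1), where M = "free_module R B", rotated -1])
      show "f \<zero>\<^bsub>free_module R B\<^esub> = g \<zero>\<^bsub>free_module R B\<^esub>"
        using End_alg_apply_zero[OF M] f g by simp
    qed (use f g basis in \<open>auto simp: End_alg_def\<close>)
  next
    case False
    then show ?thesis using f g by (auto simp: End_alg_def PiE_iff extensional_def)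
  qed
qed

lemma eval_term_closed:
  assumes "assoc_algebra R B" and "f \<in> X \<rightarrow> carrier B" and "t \<in> alg_terms R X"
  shows "eval_term B f t \<in> carrier B"
proof -
  interpret assoc_algebra R B by fact
  show ?thesis using assms(3,2) by induction (auto intro: mult_closed)
qed


section \<open>Prepending and removing edges\<close>

text \<open>
  Splitting off the head turns the index-based definition of finite paths into one by recursion.
  For nonempty \<open>es\<close> the source of the remaining path is the source of its first edge, so the
  condition on \<open>e\<close> is the matching of consecutive edges; for empty \<open>es\<close> it is the sink \<open>v\<close>, and the
  same condition says that \<open>v\<close> lies in the range of the last edge.
\<close>

lemma FinPath_in_basis:
  "FinPath [] v \<in> path_basis G \<longleftrightarrow> v \<in> sinks G"
  "FinPath (e # es) v \<in> path_basis G \<longleftrightarrow>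
    e \<in> edges G \<and> path_src G (FinPath es v) \<in> rng G e \<and> FinPath es v \<in> path_basis G"
proof -
  show "FinPath [] v \<in> path_basis G \<longleftrightarrow> v \<in> sinks G"
    by (auto simp: path_basis_def sink_paths_def infinite_paths_def is_finite_path_def)
  show "FinPath (e # es) v \<in> path_basis G \<longleftrightarrow>
    e \<in> edges G \<and> path_src G (FinPath es v) \<in> rng G e \<and> FinPath es v \<in> path_basis G"
  proof (cases es)
    case Nil
    then show ?thesis
      by (auto simp: path_basis_def sink_paths_def infinite_paths_def is_finite_path_def)
  next
    case (Cons f fs)
    have all_nat_split: "(\<forall>i. P i) \<longleftrightarrow> P 0 \<and> (\<forall>i. P (Suc i))" for P
      by (metis nat.exhaust)
    have "(\<forall>i. Suc i < length (e # es) \<longrightarrow> src G ((e # es) ! Suc i) \<in> rng G ((e # es) ! i))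
      \<longleftrightarrow> src G f \<in> rng G e \<and> (\<forall>i. Suc i < length es \<longrightarrow> src G (es ! Suc i) \<in> rng G (es ! i))"
      unfolding Cons by (subst all_nat_split) auto
    then show ?thesis
      unfolding Cons
      by (auto simp: path_basis_def sink_paths_def infinite_paths_def is_finite_path_def)
  qed
qed

lemma InfPath_in_basis:
  "InfPath f \<in> path_basis G \<longleftrightarrow> (\<forall>i. f i \<in> edges G) \<and> (\<forall>i. src G (f (Suc i)) \<in> rng G (f i))"
  by (auto simp: path_basis_def sink_paths_def infinite_paths_def)

lemma path_cons_simps:
  "path_src G (path_cons e \<alpha>) = src G e"
  "first_edge (path_cons e \<alpha>) = Some e"
  "path_tl (path_cons e \<alpha>) = \<alpha>"
  by (cases \<alpha>; simp)+

lemma path_cons_in_basis: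
  assumes "e \<in> edges G" and "\<alpha> \<in> path_basis G" and "path_src G \<alpha> \<in> rng G e"
  shows "path_cons e \<alpha> \<in> path_basis G"
  using assms by (cases \<alpha>) (auto simp: FinPath_in_basis InfPath_in_basis split: nat.split)

lemma first_edge_in_basis:
  assumes "\<alpha> \<in> path_basis G" and "first_edge \<alpha> = Some e"
  shows "e \<in> edges G" and "path_src G \<alpha> = src G e" and "path_cons e (path_tl \<alpha>) = \<alpha>"
    and "path_tl \<alpha> \<in> path_basis G" and "path_src G (path_tl \<alpha>) \<in> rng G e"
  using assms
  by (cases \<alpha> rule: first_edge.cases;
      auto simp: FinPath_in_basis InfPath_in_basis fun_eq_iff split: nat.split)+

lemma first_edge_None_in_basis:
  assumes "\<alpha> \<in> path_basis G" and "first_edge \<alpha> = None"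
  shows "path_src G \<alpha> \<in> sinks G"
  using assms by (cases \<alpha> rule: first_edge.cases) (auto simp: FinPath_in_basis)


section \<open>The operators on the path module\<close>

lemma module_path_module: "cring R \<Longrightarrow> module R (path_module R G)"
  unfolding path_module_def by (rule module_free_module)

lemma path_vec_carrier: "cring R \<Longrightarrow> path_vec R G \<alpha> \<in> carrier (path_module R G)"
  unfolding path_vec_def path_module_def by (rule basis_vec_carrier)

fun lpa_op ::
  "('r, 'm) ring_scheme \<Rightarrow> ('v, 'e) ultragraph \<Rightarrow> ('v, 'e) lpa_gen
    \<Rightarrow> (('v, 'e) upath \<Rightarrow> 'r) \<Rightarrow> (('v, 'e) upath \<Rightarrow> 'r)" where
  "lpa_op R G (GenP A) = op_P R G A"
| "lpa_op R G (GenS e) = op_S R G e"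
| "lpa_op R G (GenSstar e) = op_Sstar R G e"

lemma lpa_op_in_End:
  assumes "cring R"
  shows "lpa_op R G g \<in> carrier (End_alg R (path_module R G))"
proof -
  interpret module R "path_module R G" by (rule module_path_module[OF assms])
  have "lin_ext R (path_basis G) (path_module R G) T \<in> carrier (End_alg R (path_module R G))"
    if "T \<in> path_basis G \<rightarrow> carrier (path_module R G)" for T
    using lin_ext_in_End[OF assms] that by (simp add: path_module_def)
  then show ?thesis
    by (cases g) (auto simp: op_P_def op_S_def op_Sstar_def path_vec_carrier[OF assms])
qed

lemma op_apply:
  assumes "cring R" and "\<alpha> \<in> path_basis G"
  shows "op_P R G A (path_vec R G \<alpha>) =
      (if path_src G \<alpha> \<in> A then path_vec R G \<alpha> else \<zero>\<^bsub>path_module R G\<^esub>)"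
    and "op_S R G e (path_vec R G \<alpha>) =
      (if path_src G \<alpha> \<in> rng G e then path_vec R G (path_cons e \<alpha>) else \<zero>\<^bsub>path_module R G\<^esub>)"
    and "op_Sstar R G e (path_vec R G \<alpha>) =
      (if first_edge \<alpha> = Some e then path_vec R G (path_tl \<alpha>) else \<zero>\<^bsub>path_module R G\<^esub>)"
proof -
  interpret module R "path_module R G" by (rule module_path_module[OF assms(1)])
  have "lin_ext R (path_basis G) (path_module R G) T (path_vec R G \<alpha>) = T \<alpha>"
    if "T \<alpha> \<in> carrier (path_module R G)" for T
    unfolding path_vec_def
    using that by (rule lin_ext_basis_vec[OF module_path_module[OF assms(1)] assms(2)])
  note * = this
  show "op_P R G A (path_vec R G \<alpha>) =
      (if path_src G \<alpha> \<in> A then path_vec R G \<alpha> else \<zero>\<^bsub>path_module R G\<^esub>)"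
    unfolding op_P_def by (subst *) (auto simp: path_vec_carrier[OF assms(1)])
  show "op_S R G e (path_vec R G \<alpha>) =
      (if path_src G \<alpha> \<in> rng G e then path_vec R G (path_cons e \<alpha>) else \<zero>\<^bsub>path_module R G\<^esub>)"
    unfolding op_S_def by (subst *) (auto simp: path_vec_carrier[OF assms(1)])
  show "op_Sstar R G e (path_vec R G \<alpha>) =
      (if first_edge \<alpha> = Some e then path_vec R G (path_tl \<alpha>) else \<zero>\<^bsub>path_module R G\<^esub>)"
    unfolding op_Sstar_def by (subst *) (auto simp: path_vec_carrier[OF assms(1)])
qed

lemma op_apply_zero:
  assumes "cring R"
  shows "op_P R G A \<zero>\<^bsub>path_module R G\<^esub> = \<zero>\<^bsub>path_module R G\<^esub>"
    and "op_S R G e \<zero>\<^bsub>path_module R G\<^esub> = \<zero>\<^bsub>path_module R G\<^esub>"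
    and "op_Sstar R G e \<zero>\<^bsub>path_module R G\<^esub> = \<zero>\<^bsub>path_module R G\<^esub>"
  using End_alg_apply_zero[OF module_path_module[OF assms] lpa_op_in_End[OF assms]]
  by (metis lpa_op.simps)+

text \<open>
  Distinctness of the list matters: a repeated edge would contribute the same basis vector
  more than once.
\<close>

lemma eval_edge_sum_apply:
  assumes "cring R" and \<alpha>: "\<alpha> \<in> path_basis G" and "distinct es"
  shows "eval_term (End_alg R (path_module R G)) (lpa_op R G)
      (foldr (\<lambda>e t. TPlus (TTimes (tS e) (tSstar e)) t) es TZero) (path_vec R G \<alpha>) =
    (if \<exists>e\<in>set es. first_edge \<alpha> = Some e then path_vec R G \<alpha> else \<zero>\<^bsub>path_module R G\<^esub>)"
proof -
  interpret module R "path_module R G" by (rule module_path_module[OF assms(1)])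
  note [simp] = path_vec_carrier[OF assms(1)]
  show ?thesis
    using assms(3)
    by (induction es)
       (auto simp: End_alg_apply op_apply[OF assms(1)] op_apply_zero[OF assms(1)] \<alpha>
         first_edge_in_basis[OF \<alpha>])
qed

lemma eval_lpa_rels:
  assumes "ultragraph G" and "cring R" and rel: "(t, u) \<in> lpa_rels R G"
  shows "eval_term (End_alg R (path_module R G)) (lpa_op R G) t =
    eval_term (End_alg R (path_module R G)) (lpa_op R G) u"
proof -
  interpret module R "path_module R G" by (rule module_path_module[OF assms(2)])
  note [simp] = path_vec_carrier[OF assms(2)]
  have closed: "eval_term (End_alg R (path_module R G)) (lpa_op R G) w
      \<in> carrier (End_alg R (free_module R (path_basis G)))" if "w \<in> alg_terms R (lpa_gens G)" for w
    unfolding path_module_def[symmetric]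
    using eval_term_closed[OF assoc_algebra_End[OF module_path_module[OF assms(2)]] _ that]
      lpa_op_in_End[OF assms(2)]
    by blast
  have terms: "t \<in> alg_terms R (lpa_gens G)" "u \<in> alg_terms R (lpa_gens G)"
    using lpa_rels_in_terms[OF assms(2,1) rel] by auto
  note evals = End_alg_apply op_apply[OF assms(2)] op_apply_zero[OF assms(2)]
  show ?thesis
  proof (rule End_free_module_eqI[OF assms(2) closed[OF terms(1)] closed[OF terms(2)]],
      fold path_vec_def)
    fix \<alpha>
    assume \<alpha>: "\<alpha> \<in> path_basis G"
    from rel show "eval_term (End_alg R (path_module R G)) (lpa_op R G) t (path_vec R G \<alpha>) =
      eval_term (End_alg R (path_module R G)) (lpa_op R G) u (path_vec R G \<alpha>)"
    proof cases
      case (union A B)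
      \<comment> \<open>The only basis vectors for which both summands contribute are those over \<open>A \<inter> B\<close>,
          and there the subtracted term removes the double count.\<close>
      then show ?thesis
        by (auto simp: evals \<alpha> smult_l_minus M.a_assoc M.r_neg M.r_neg1 M.r_neg2)
    next
      case (ck v es)
      have "(\<exists>e\<in>set es. first_edge \<alpha> = Some e) \<longleftrightarrow> path_src G \<alpha> = v"
      proof
        assume "path_src G \<alpha> = v"
        moreover have "v \<notin> sinks G" using ck by (auto simp: sinks_def)
        ultimately obtain e where e: "first_edge \<alpha> = Some e"
          using first_edge_None_in_basis[OF \<alpha>] by (cases "first_edge \<alpha>") auto
        then show "\<exists>e\<in>set es. first_edge \<alpha> = Some e"
          using first_edge_in_basis[OF \<alpha> e] ck \<open>path_src G \<alpha> = v\<close> by (auto simp: out_edges_def)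
      qed (use first_edge_in_basis[OF \<alpha>] ck in \<open>auto simp: out_edges_def\<close>)
      then show ?thesis
        using ck eval_edge_sum_apply[OF assms(2) \<alpha>] by (simp add: evals \<alpha>)
    qed (auto simp: evals \<alpha> path_cons_in_basis[OF _ \<alpha>] path_cons_simps first_edge_in_basis[OF \<alpha>])
  qed
qed


section \<open>The representation\<close>

theorem theorem3p7:
  fixes G :: "('v, 'e) ultragraph" and R :: "('r, 'm) ring_scheme"
  assumes "ultragraph G" and "cring R"
  shows "\<exists>\<pi> \<in> representations R (leavitt_path_algebra R G) (path_module R G).
           (\<forall>A \<in> gen_verts G. \<pi> (lpa_p R G A) = op_P R G A) \<and>
           (\<forall>e \<in> edges G. \<pi> (lpa_s R G e) = op_S R G e \<and> \<pi> (lpa_sstar R G e) = op_Sstar R G e)"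
proof -
  obtain \<pi> where \<pi>: "\<pi> \<in> alg_hom R (leavitt_path_algebra R G) (End_alg R (path_module R G))"
    and gens: "\<And>g. g \<in> lpa_gens G
      \<Longrightarrow> \<pi> (presented_gen R (lpa_gens G) (lpa_rels R G) g) = lpa_op R G g"
    using presented_algebra_universal[where f = "lpa_op R G" and X = "lpa_gens G"
        and E = "lpa_rels R G" and R = R,
        OF assoc_algebra_End[OF module_path_module[OF assms(2)]]]
      lpa_op_in_End[OF assms(2)] eval_lpa_rels[OF assms]
    unfolding leavitt_path_algebra_def by blast
  show ?thesis
    using \<pi> gens
    by (intro bexI[of _ \<pi>])
       (auto simp: representations_def lpa_p_def lpa_s_def lpa_sstar_def lpa_gens_def)
qed

end
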